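(* Let $p$ be a prime number and $q$ a nonzero integer. The map $\phi_{p,q}:\mathbf{Z}_p\to\mathbf{Z}_p$ defined by $$\forall u\in\mathbf{Z}_p,\quad \phi_{p,q}(u)=\sum_{n=0}^\infty\epsilon_0(-qu_n)p^n,\qquad u_n=g_{p,q}^n(u),$$ (the sum being taken in the $p$-adic sense) is an isometry of $\mathbf{Z}_p$.
   Context: $\mathbf{Z}_p$ is the ring of $p$-adic integers with the distance $|x-y|_p=p^{-\nu_p(x-y)}$, where $\nu_p$ is the $p$-adic valuation. For $x\in\mathbf{Z}_p$, $\epsilon_0(x)\in\{0,1,\dots,p-1\}$ is the unique element with $\epsilon_0(x)\equiv x\pmod p$. The map $g_{p,q}:\mathbf{Z}_p\to\mathbf{Z}_p$ is defined by $g_{p,q}(x)=\frac{x}{p}$ if $p\mid x$ and $g_{p,q}(x)=\frac{qx+\epsilon_0(-qx)}{p}$ otherwise; $g_{p,q}^n$ is its $n$-th iterate.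
   Formalization: The formal theorem additionally assumes that p does not divide q; when p divides q, every digit ε₀(-q u_n) is 0, so φ_{p,q} is the zero map and the claim is false. *)

theory Defs
  imports "HOL-Analysis.Analysis" "Berlekamp_Zassenhaus.Finite_Field"
begin

section \<open>The ring of \<open>p\<close>-adic integers\<close>

text \<open>
  The prime \<open>p\<close> is the cardinality of the type parameter (class \<^class>\<open>prime_card\<close>), and the
  \<open>p\<close>-adic integers are the inverse limit of the rings \<open>\<int>/p\<^sup>n\<int>\<close>, each residue class being
  represented by its least nonnegative element.
\<close>

typedef ('p::prime_card) padic_int =
  "{x :: nat \<Rightarrow> int. \<forall>n. x n \<in> {0..<int CARD('p) ^ n} \<and> x (Suc n) mod int CARD('p) ^ n = x n}"
  morphisms residue Abs_padic_int
  using prime_card[where ?'a='p] by (intro exI[of _ "\<lambda>_. 0"]) (auto dest: prime_gt_0_nat)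

setup_lifting type_definition_padic_int

lemma CARD_pos [simp]: "int CARD('p::prime_card) > 0"
  using prime_card_int[where ?'a='p] prime_gt_0_int by blast

lemma residue_range:
  fixes x :: "'p::prime_card padic_int"
  shows "0 \<le> residue x n" "residue x n < int CARD('p) ^ n"
  using residue[of x] by auto

lemma residue_Suc_mod:
  fixes x :: "'p::prime_card padic_int"
  shows "residue x (Suc n) mod int CARD('p) ^ n = residue x n"
  using residue[of x] by auto

lemma residue_mod_self [simp]:
  fixes x :: "'p::prime_card padic_int"
  shows "residue x n mod int CARD('p) ^ n = residue x n"
  using residue_range[of x n] by simp

lemma residue_add_mod:
  fixes x :: "'p::prime_card padic_int"
  shows "residue x (m + n) mod int CARD('p) ^ n = residue x n"
proof (induction m)
  case (Suc m)
  have "residue x (Suc m + n) mod int CARD('p) ^ n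
      = residue x (Suc (m + n)) mod int CARD('p) ^ (m + n) mod int CARD('p) ^ n"
    by (simp add: mod_mod_cancel le_imp_power_dvd)
  then show ?case
    by (simp add: residue_Suc_mod Suc.IH)
qed simp

lemma residue_le_mod:
  fixes x :: "'p::prime_card padic_int"
  assumes "n \<le> m"
  shows "residue x m mod int CARD('p) ^ n = residue x n"
  using residue_add_mod[of x "m - n" n] assms by simp

lemma padic_int_eqI:
  fixes x y :: "'p::prime_card padic_int"
  assumes "\<And>n. residue x n = residue y n"
  shows "x = y"
  using assms by (metis ext residue_inject)

lemma coherent_mod:
  fixes f :: "nat \<Rightarrow> int"
  assumes "\<And>n. f (Suc n) mod int CARD('p::prime_card) ^ n = f n mod int CARD('p) ^ n"
  shows "f n mod int CARD('p) ^ n \<in> {0..<int CARD('p) ^ n} \<and>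
    f (Suc n) mod int CARD('p) ^ Suc n mod int CARD('p) ^ n = f n mod int CARD('p) ^ n"
  using assms by (auto simp: mod_mod_cancel le_imp_power_dvd)

lemma padic_int_of_coherent:
  fixes f :: "nat \<Rightarrow> int"
  assumes "\<And>n. f (Suc n) mod int CARD('p) ^ n = f n mod int CARD('p) ^ n"
  obtains y :: "'p::prime_card padic_int" where "\<And>n. residue y n = f n mod int CARD('p) ^ n"
proof
  show "residue (Abs_padic_int (\<lambda>n. f n mod int CARD('p) ^ n) :: 'p padic_int) n
      = f n mod int CARD('p) ^ n" for n
    by (subst Abs_padic_int_inverse) (use coherent_mod[of f, OF assms] in blast)+
qed

instantiation padic_int :: (prime_card) comm_ring_1
begin

lift_definition zero_padic_int :: "'a padic_int" is "\<lambda>n. 0 mod int CARD('a) ^ n"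
  by simp

lift_definition one_padic_int :: "'a padic_int" is "\<lambda>n. 1 mod int CARD('a) ^ n"
  by (rule coherent_mod[of "\<lambda>_. 1"]) simp

lift_definition plus_padic_int :: "'a padic_int \<Rightarrow> 'a padic_int \<Rightarrow> 'a padic_int"
  is "\<lambda>x y n. (x n + y n) mod int CARD('a) ^ n"
  subgoal for x y n
    by (rule coherent_mod[of "\<lambda>n. x n + y n"]) (metis mod_add_eq)
  done

lift_definition uminus_padic_int :: "'a padic_int \<Rightarrow> 'a padic_int"
  is "\<lambda>x n. (- x n) mod int CARD('a) ^ n"
  subgoal for x n
    by (rule coherent_mod[of "\<lambda>n. - x n"]) (metis mod_minus_eq)
  done

lift_definition minus_padic_int :: "'a padic_int \<Rightarrow> 'a padic_int \<Rightarrow> 'a padic_int"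
  is "\<lambda>x y n. (x n - y n) mod int CARD('a) ^ n"
  subgoal for x y n
    by (rule coherent_mod[of "\<lambda>n. x n - y n"]) (metis mod_diff_eq)
  done

lift_definition times_padic_int :: "'a padic_int \<Rightarrow> 'a padic_int \<Rightarrow> 'a padic_int"
  is "\<lambda>x y n. (x n * y n) mod int CARD('a) ^ n"
  subgoal for x y n
    by (rule coherent_mod[of "\<lambda>n. x n * y n"]) (metis mod_mult_eq)
  done

lemma residue_simps:
  fixes x y :: "'a padic_int"
  shows "residue (0 :: 'a padic_int) n = 0"
    and "residue (1 :: 'a padic_int) n = 1 mod int CARD('a) ^ n"
    and "residue (x + y) n = (residue x n + residue y n) mod int CARD('a) ^ n"
    and "residue (- x) n = (- residue x n) mod int CARD('a) ^ n"
    and "residue (x - y) n = (residue x n - residue y n) mod int CARD('a) ^ n"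
    and "residue (x * y) n = (residue x n * residue y n) mod int CARD('a) ^ n"
  by (transfer; simp)+

instance
proof
  fix a b c :: "'a padic_int"
  show "a * b * c = a * (b * c)"
    by (rule padic_int_eqI) (simp add: residue_simps mod_simps mult.assoc)
  show "a * b = b * a"
    by (rule padic_int_eqI) (simp add: residue_simps mult.commute)
  show "1 * a = a"
    by (rule padic_int_eqI) (simp add: residue_simps mod_simps)
  show "a + b + c = a + (b + c)"
    by (rule padic_int_eqI) (simp add: residue_simps mod_simps add.assoc)
  show "a + b = b + a"
    by (rule padic_int_eqI) (simp add: residue_simps add.commute)
  show "0 + a = a"
    by (rule padic_int_eqI) (simp add: residue_simps)
  show "- a + a = 0"
    by (rule padic_int_eqI) (simp add: residue_simps mod_simps)
  show "a - b = a + - b"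
    by (rule padic_int_eqI) (simp add: residue_simps mod_simps)
  show "(a + b) * c = a * c + b * c"
    by (rule padic_int_eqI) (simp add: residue_simps mod_simps distrib_right)
  show "(0 :: 'a padic_int) \<noteq> 1"
  proof
    assume "(0 :: 'a padic_int) = 1"
    then have "residue (0 :: 'a padic_int) 1 = residue (1 :: 'a padic_int) 1"
      by simp
    then show False
      using prime_gt_1_int[OF prime_card_int[where ?'a='a]] by (simp add: residue_simps)
  qed
qed

end

lemma residue_of_nat: "residue (of_nat k :: 'p::prime_card padic_int) n = int k mod int CARD('p) ^ n"
  by (induction k) (simp_all add: residue_simps mod_simps)

lemma residue_of_int: "residue (of_int k :: 'p::prime_card padic_int) n = k mod int CARD('p) ^ n"
  by (cases k) (simp_all add: residue_simps residue_of_nat mod_simps)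

lemma residue_nonzero:
  fixes x :: "'p::prime_card padic_int"
  assumes "x \<noteq> 0"
  obtains m where "\<And>n. m \<le> n \<Longrightarrow> \<not> int CARD('p) ^ m dvd residue x n"
proof -
  obtain m where m: "residue x m \<noteq> 0"
    using assms padic_int_eqI[of x 0] by (auto simp: residue_simps)
  then have "\<not> int CARD('p) ^ m dvd residue x n" if "m \<le> n" for n
    using residue_le_mod[OF that, of x] by (metis dvd_imp_mod_0)
  with that show thesis
    by blast
qed

instantiation padic_int :: (prime_card) idom_divide
begin

definition divide_padic_int :: "'a padic_int \<Rightarrow> 'a padic_int \<Rightarrow> 'a padic_int" where
  "divide_padic_int x y = (if y = 0 then 0 else THE z. z * y = x)"

instance
proof
  show no_zero_div: "a * b \<noteq> 0" if "a \<noteq> 0" "b \<noteq> 0" for a b :: "'a padic_int"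
  proof
    assume "a * b = 0"
    obtain k where k: "\<And>n. k \<le> n \<Longrightarrow> \<not> int CARD('a) ^ k dvd residue a n"
      using residue_nonzero \<open>a \<noteq> 0\<close> by blast
    obtain l where l: "\<And>n. l \<le> n \<Longrightarrow> \<not> int CARD('a) ^ l dvd residue b n"
      using residue_nonzero \<open>b \<noteq> 0\<close> by blast
    have "residue (a * b) (k + l) = 0"
      using \<open>a * b = 0\<close> by (simp add: residue_simps)
    then have "int CARD('a) ^ (k + l) dvd residue a (k + l) * residue b (k + l)"
      by (simp add: residue_simps mod_eq_0_iff_dvd)
    from prime_elem_power_dvd_prod[OF this] obtain r s where rs: "r + s = k + l"
        "int CARD('a) ^ r dvd residue a (k + l)" "int CARD('a) ^ s dvd residue b (k + l)"
      using prime_card_int[where ?'a='a] by auto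
    then consider "k \<le> r" | "l \<le> s"
      by linarith
    then show False
      using power_le_dvd[OF rs(2), of k] power_le_dvd[OF rs(3), of l] k[of "k + l"] l[of "k + l"]
      by cases simp_all
  qed
  show "a * b div b = a" if "b \<noteq> 0" for a b :: "'a padic_int"
  proof -
    have "z = a" if "z * b = a * b" for z
    proof -
      have "(z - a) * b = 0"
        using that by (simp add: left_diff_distrib)
      then show ?thesis
        using no_zero_div[of "z - a" b] \<open>b \<noteq> 0\<close> by auto
    qed
    then show ?thesis
      using that by (auto simp: divide_padic_int_def)
  qed
  show "a div 0 = 0" for a :: "'a padic_int"
    by (simp add: divide_padic_int_def)
qed

end

lemma p_power_dvd_iff_residue:
  fixes x :: "'p::prime_card padic_int"
  shows "of_nat CARD('p) ^ n dvd x \<longleftrightarrow> residue x n = 0"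
proof
  have pow: "residue (of_nat CARD('p) ^ n :: 'p padic_int) m = int CARD('p) ^ n mod int CARD('p) ^ m" for m
    using residue_of_nat[of "CARD('p) ^ n" m, where ?'p='p] by simp
  assume "of_nat CARD('p) ^ n dvd x"
  then show "residue x n = 0"
    by (auto simp: residue_simps pow)
next
  have pow: "residue (of_nat CARD('p) ^ n :: 'p padic_int) m = int CARD('p) ^ n mod int CARD('p) ^ m" for m
    using residue_of_nat[of "CARD('p) ^ n" m, where ?'p='p] by simp
  assume x: "residue x n = 0"
  define f where "f m = residue x (m + n) div int CARD('p) ^ n" for m
  have f: "residue x (m + n) = int CARD('p) ^ n * f m" for m
    using x residue_add_mod[of x m n] by (auto simp: f_def mod_eq_0_iff_dvd)
  have "f (Suc m) mod int CARD('p) ^ m = f m mod int CARD('p) ^ m" for m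
  proof -
    have pow_add: "int CARD('p) ^ n * int CARD('p) ^ m = int CARD('p) ^ (m + n)"
      by (metis add.commute power_add)
    have "int CARD('p) ^ n * (f (Suc m) mod int CARD('p) ^ m)
        = residue x (Suc (m + n)) mod int CARD('p) ^ (m + n)"
      unfolding mult_mod_right pow_add using f[of "Suc m"] by simp
    also have "\<dots> = residue x (m + n) mod int CARD('p) ^ (m + n)"
      unfolding residue_Suc_mod by simp
    also have "\<dots> = int CARD('p) ^ n * (f m mod int CARD('p) ^ m)"
      unfolding mult_mod_right pow_add f ..
    finally show ?thesis
      using CARD_pos[where ?'p='p] by simp
  qed
  then obtain y :: "'p padic_int" where y: "\<And>m. residue y m = f m mod int CARD('p) ^ m"
    using padic_int_of_coherent by blast
  have "x = of_nat CARD('p) ^ n * y"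
  proof (rule padic_int_eqI)
    fix m
    have "residue x m = residue x (n + m) mod int CARD('p) ^ m"
      by (simp add: residue_add_mod)
    also have "\<dots> = (int CARD('p) ^ n * f m) mod int CARD('p) ^ m"
      using f[of m] by (simp add: add.commute)
    finally show "residue x m = residue (of_nat CARD('p) ^ n * y) m"
      by (simp add: residue_simps pow y mod_simps)
  qed
  then show "of_nat CARD('p) ^ n dvd x"
    by simp
qed

section \<open>The \<open>p\<close>-adic distance\<close>

text \<open>The value at \<open>0\<close> is irrelevant: the distance treats equal points separately.\<close>

definition padic_val :: "'p::prime_card padic_int \<Rightarrow> nat" where
  "padic_val x = (GREATEST n. of_nat CARD('p) ^ n dvd x)"

lemma p_power_dvd_iff_le_padic_val:
  fixes x :: "'p::prime_card padic_int"
  assumes "x \<noteq> 0"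
  shows "of_nat CARD('p) ^ n dvd x \<longleftrightarrow> n \<le> padic_val x"
proof -
  obtain m where m: "\<And>n. m \<le> n \<Longrightarrow> \<not> int CARD('p) ^ m dvd residue x n"
    using residue_nonzero[OF assms] by blast
  have bound: "k \<le> m" if "of_nat CARD('p) ^ k dvd x" for k
    using that m[of k] by (metis dvd_0_right nle_le p_power_dvd_iff_residue)
  have "of_nat CARD('p) ^ padic_val x dvd x"
    unfolding padic_val_def
    by (rule GreatestI_nat[where P = "\<lambda>n. of_nat CARD('p) ^ n dvd x" and k = 0 and b = m])
      (use bound in auto)
  moreover have "n \<le> padic_val x" if "of_nat CARD('p) ^ n dvd x"
    unfolding padic_val_def
    by (rule Greatest_le_nat[where P = "\<lambda>n. of_nat CARD('p) ^ n dvd x" and b = m])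
      (use bound that in auto)
  ultimately show ?thesis
    using power_le_dvd by blast
qed

instantiation padic_int :: (prime_card) metric_space
begin

definition dist_padic_int :: "'a padic_int \<Rightarrow> 'a padic_int \<Rightarrow> real" where
  "dist_padic_int x y = (if x = y then 0 else real CARD('a) powi (- int (padic_val (x - y))))"

definition uniformity_padic_int :: "('a padic_int \<times> 'a padic_int) filter" where
  "uniformity_padic_int = (INF e\<in>{0<..}. principal {(x, y). dist x y < e})"

definition open_padic_int :: "'a padic_int set \<Rightarrow> bool" where
  "open_padic_int U = (\<forall>x\<in>U. \<forall>\<^sub>F (x', y) in uniformity. x' = x \<longrightarrow> y \<in> U)"

lemma dist_padic_int_le_iff:
  fixes x y :: "'a padic_int"
  shows "dist x y \<le> inverse (real CARD('a) ^ n) \<longleftrightarrow> of_nat CARD('a) ^ n dvd x - y"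
proof (cases "x = y")
  case False
  have "real CARD('a) > 1"
    using prime_gt_1_nat[OF prime_card[where ?'a='a]] by simp
  then show ?thesis
    using False by (simp add: dist_padic_int_def power_int_minus p_power_dvd_iff_le_padic_val)
qed (simp add: dist_padic_int_def)

instance
proof
  show "uniformity = (INF e\<in>{0<..}. principal {(x :: 'a padic_int, y). dist x y < e})"
    by (fact uniformity_padic_int_def)
  show "open U = (\<forall>x\<in>U. \<forall>\<^sub>F (x', y) in uniformity. x' = x \<longrightarrow> y \<in> U)" for U :: "'a padic_int set"
    by (fact open_padic_int_def)
  have p: "real CARD('a) > 1"
    using prime_gt_1_nat[OF prime_card[where ?'a='a]] by simp
  have nonneg: "0 \<le> dist x y" for x y :: "'a padic_int"
    by (simp add: dist_padic_int_def)
  show zero: "dist x y = 0 \<longleftrightarrow> x = y" for x y :: "'a padic_int"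
    using p by (simp add: dist_padic_int_def)
  show "dist x y \<le> dist x z + dist y z" for x y z :: "'a padic_int"
  proof -
    have dist_eq: "\<exists>n. dist u v = inverse (real CARD('a) ^ n)" if "u \<noteq> v" for u v :: "'a padic_int"
      using that by (auto simp: dist_padic_int_def power_int_minus)
    have sym: "dist u v = dist v u" for u v :: "'a padic_int"
    proof -
      have "c dvd u - v \<longleftrightarrow> c dvd v - u" for c
        using dvd_minus_iff[of c "u - v"] by (simp only: minus_diff_eq)
      then have "padic_val (u - v) = padic_val (v - u)"
        by (simp only: padic_val_def)
      then show ?thesis
        by (auto simp: dist_padic_int_def)
    qed
    have ultra: "dist x y \<le> inverse (real CARD('a) ^ n)"
      if "dist x z \<le> inverse (real CARD('a) ^ n)" "dist z y \<le> inverse (real CARD('a) ^ n)" for n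
      using that dvd_add[of "of_nat CARD('a) ^ n" "x - z" "z - y"]
      by (simp add: dist_padic_int_le_iff)
    consider "x = z" | "y = z" | "x \<noteq> z" "y \<noteq> z" by blast
    then show ?thesis
    proof cases
      case 1 then show ?thesis using zero[of x z] sym[of z y] by simp
    next
      case 2 then show ?thesis using zero[of y z] by simp
    next
      case 3
      then obtain k l where kl: "dist x z = inverse (real CARD('a) ^ k)"
          "dist z y = inverse (real CARD('a) ^ l)"
        using dist_eq by metis
      show ?thesis
        using ultra[of k] ultra[of l] kl nonneg[of x z] nonneg[of y z] sym[of z y]
        by linarith
    qed
  qed
qed

end

section \<open>The maps \<open>g\<close> and \<open>\<phi>\<close>\<close>

definition eps0 :: "'p::prime_card padic_int \<Rightarrow> nat" where
  "eps0 x = (THE e. e < CARD('p) \<and> of_nat CARD('p) dvd x - of_nat e)"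

lemma
  fixes x :: "'p::prime_card padic_int"
  shows eps0_less: "eps0 x < CARD('p)"
    and eps0_dvd: "of_nat CARD('p) dvd x - of_nat (eps0 x)"
    and eps0_eqI: "e < CARD('p) \<Longrightarrow> of_nat CARD('p) dvd x - of_nat e \<Longrightarrow> eps0 x = e"
proof -
  have iff: "of_nat CARD('p) dvd x - of_nat e \<longleftrightarrow> int e = residue x 1" if "e < CARD('p)" for e
  proof -
    have "of_nat CARD('p) dvd x - of_nat e \<longleftrightarrow> (residue x 1 - int e) mod int CARD('p) = 0"
      using p_power_dvd_iff_residue[of 1 "x - of_nat e"]
      by (simp add: residue_simps residue_of_nat mod_simps)
    also have "\<dots> \<longleftrightarrow> residue x 1 mod int CARD('p) = int e mod int CARD('p)"
      by (simp add: mod_eq_dvd_iff mod_eq_0_iff_dvd)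
    finally show ?thesis
      using that residue_range[of x 1] by auto
  qed
  have ex1: "\<exists>!e. e < CARD('p) \<and> of_nat CARD('p) dvd x - of_nat e"
  proof (rule ex1I[of _ "nat (residue x 1)"])
    show "nat (residue x 1) < CARD('p) \<and> of_nat CARD('p) dvd x - of_nat (nat (residue x 1))"
      using residue_range[of x 1] iff[of "nat (residue x 1)"] by auto
  qed (use iff in auto)
  from theI'[OF this] show "eps0 x < CARD('p)" and "of_nat CARD('p) dvd x - of_nat (eps0 x)"
    by (simp_all add: eps0_def)
  with ex1 show "eps0 x = e" if "e < CARD('p)" "of_nat CARD('p) dvd x - of_nat e"
    using that by blast
qed

text \<open>Both divisions below are exact, see \<open>g_map_exact\<close>.\<close>

definition g_map :: "int \<Rightarrow> 'p::prime_card padic_int \<Rightarrow> 'p padic_int" where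
  "g_map q x =
    (if of_nat CARD('p) dvd x then x div of_nat CARD('p)
     else (of_int q * x + of_nat (eps0 (- (of_int q * x)))) div of_nat CARD('p))"

lemma g_map_exact:
  fixes x :: "'p::prime_card padic_int"
  shows "of_nat CARD('p) * g_map q x =
    (if of_nat CARD('p) dvd x then x else of_int q * x + of_nat (eps0 (- (of_int q * x))))"
proof -
  have "of_nat CARD('p) dvd - (- (of_int q * x) - of_nat (eps0 (- (of_int q * x))))"
    using eps0_dvd[of "- (of_int q * x)"] by (simp only: dvd_minus_iff)
  then have "of_nat CARD('p) dvd of_int q * x + of_nat (eps0 (- (of_int q * x)))"
    by (simp add: algebra_simps)
  moreover have "of_nat CARD('p) * (y div of_nat CARD('p)) = y"
    if "of_nat CARD('p) dvd y" for y :: "'p padic_int"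
    using that by (metis dvdE mult_zero_left nonzero_mult_div_cancel_left)
  ultimately show ?thesis
    by (simp add: g_map_def)
qed

definition phi_map :: "int \<Rightarrow> 'p::prime_card padic_int \<Rightarrow> 'p padic_int" where
  "phi_map q u = (\<Sum>n. of_nat (eps0 (- (of_int q * (g_map q ^^ n) u))) * of_nat CARD('p) ^ n)"

text \<open>The series defining \<^const>\<open>phi_map\<close> always converges.\<close>

lemma summable_padic_digits:
  fixes a :: "nat \<Rightarrow> nat"
  shows "summable (\<lambda>n. of_nat (a n) * of_nat CARD('p) ^ n :: 'p::prime_card padic_int)"
proof -
  define s where "s n = (\<Sum>i<n. a i * CARD('p) ^ i)" for n
  have "int (s (Suc n)) mod int CARD('p) ^ n = int (s n) mod int CARD('p) ^ n" for n
    by (simp add: s_def)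
  then obtain y :: "'p padic_int" where y: "\<And>n. residue y n = int (s n) mod int CARD('p) ^ n"
    using padic_int_of_coherent[of "\<lambda>n. int (s n)"] by blast
  have le: "dist (of_nat (s n)) y \<le> inverse (real CARD('p)) ^ n" for n
    using dist_padic_int_le_iff[of "of_nat (s n)" y n]
    by (simp add: p_power_dvd_iff_residue residue_simps residue_of_nat y power_inverse)
  have "real CARD('p) > 1"
    using prime_gt_1_nat[OF prime_card[where ?'a='p]] by simp
  then have "(\<lambda>n. inverse (real CARD('p)) ^ n) \<longlonglongrightarrow> 0"
    by (intro LIMSEQ_realpow_zero) (auto simp: inverse_less_1_iff)
  then have "(\<lambda>n. dist (of_nat (s n)) y) \<longlonglongrightarrow> 0"
    by (rule tendsto_sandwich[OF _ _ tendsto_const, rotated 2]) (use le in auto)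
  then have "(\<lambda>n. of_nat (s n)) \<longlonglongrightarrow> y"
    by (rule tendsto_dist_iff[THEN iffD2])
  moreover have "of_nat (s n) = (\<Sum>i<n. of_nat (a i) * of_nat CARD('p) ^ i :: 'p padic_int)" for n
    unfolding s_def of_nat_sum of_nat_mult of_nat_power ..
  ultimately show ?thesis
    unfolding summable_def sums_def by auto
qed

text \<open>
  If \<open>p\<close> divides \<open>q\<close> then all digits vanish, so \<^const>\<open>phi_map\<close> can only be an isometry for
  \<open>q\<close> coprime to \<open>p\<close>.
\<close>

lemma phi_map_eq_0:
  assumes "int CARD('p) dvd q"
  shows "phi_map q (u :: 'p::prime_card padic_int) = 0"
proof -
  obtain k where "q = int CARD('p) * k"
    using assms by blast
  then have "of_nat CARD('p) dvd (of_int q :: 'p padic_int)"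
    by simp
  then have "eps0 (- (of_int q * x)) = 0" for x :: "'p padic_int"
    using CARD_pos[where ?'p='p] by (intro eps0_eqI) auto
  then show ?thesis
    by (simp add: phi_map_def)
qed

text \<open>An isometry of a space is a distance-preserving bijection of the space onto itself.\<close>

definition isometry :: "('a::metric_space \<Rightarrow> 'a) \<Rightarrow> bool" where
  "isometry f \<longleftrightarrow> bij f \<and> (\<forall>x y. dist (f x) (f y) = dist x y)"

end

theory Submission
  imports Defs
begin

text \<open>
  Write \<open>d u = \<epsilon>\<^sub>0 (- q u)\<close> for the digit that the map \<open>\<phi>\<close> reads off from \<open>u\<close>. The defining series
  splits off its first term (\<open>phi_map_unfold\<close>):
  \<open>\<phi> u = d u + p \<sqdot> \<phi> (g u)\<close>.
  As \<open>q\<close> is invertible modulo \<open>p\<close>, the digit \<open>d u\<close> determines and is determined by \<open>u\<close> modulo \<open>p\<close>;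
  and as soon as \<open>d u = d v\<close>, the points \<open>u\<close> and \<open>v\<close> use the same branch of \<open>g\<close>, an affine map of
  slope \<open>1/p\<close> or \<open>q/p\<close>, so that \<open>g\<close> lowers the valuation of \<open>u - v\<close> by exactly one. Both steps match
  the functional equation of \<open>\<phi>\<close>, and induction on \<open>n\<close> shows that \<open>\<phi> u \<equiv> \<phi> v\<close> modulo \<open>p\<^sup>n\<close> iff
  \<open>u \<equiv> v\<close> modulo \<open>p\<^sup>n\<close> (\<open>phi_map_cong_iff\<close>). This is preservation of distances.

  For surjectivity, the functional equation is read backwards: a target \<open>w = d + p w'\<close> is hit modulo
  \<open>p\<^bsup>n+1\<^esup>\<close> by a point with first digit \<open>d\<close> that \<open>g\<close> sends close to an approximate
  preimage of \<open>w'\<close> (\<open>phi_map_approx_surj\<close>). By the congruence above, the approximate preimages of a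
  fixed target form a coherent sequence, and its limit is an exact preimage.
\<close>

section \<open>Divisibility by powers of \<open>p\<close>\<close>

lemma of_nat_CARD_neq_0: "(of_nat CARD('p) :: 'p::prime_card padic_int) \<noteq> 0"
proof
  assume "(of_nat CARD('p) :: 'p padic_int) = 0"
  then have "residue (of_nat CARD('p) :: 'p padic_int) 2 = 0"
    by (simp add: residue_simps)
  then show False
    using prime_gt_1_int[OF prime_card_int[where ?'a='p]]
    by (simp add: residue_of_nat power2_eq_square)
qed

lemma p_power_Suc_dvd_p_times:
  fixes x :: "'p::prime_card padic_int"
  shows "of_nat CARD('p) ^ Suc n dvd of_nat CARD('p) * x \<longleftrightarrow> of_nat CARD('p) ^ n dvd x"
  by (simp add: of_nat_CARD_neq_0)

lemma eq_if_all_p_powers_dvd: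
  fixes x y :: "'p::prime_card padic_int"
  assumes "\<And>n. of_nat CARD('p) ^ n dvd x - y"
  shows "x = y"
proof -
  have "x - y = 0"
    using assms by (intro padic_int_eqI) (simp add: p_power_dvd_iff_residue residue_simps(1))
  then show ?thesis
    by simp
qed

lemma digits_cong_iff:
  assumes "a < CARD('p)" "b < CARD('p)"
  shows "of_nat CARD('p) dvd (of_nat a - of_nat b :: 'p::prime_card padic_int) \<longleftrightarrow> a = b"
  using eps0_eqI[OF assms(1), of "of_nat a"] eps0_eqI[OF assms(2), of "of_nat a"] by auto

lemma inverse_mod_p_power:
  assumes "coprime q (int CARD('p::prime_card))"
  obtains a where "of_nat CARD('p) ^ n dvd (of_int q * of_int a - 1 :: 'p padic_int)"
proof -
  have "coprime q (int CARD('p) ^ n)"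
    using assms by simp
  then obtain a where "[q * a = 1] (mod int CARD('p) ^ n)"
    using cong_solve_coprime_int by blast
  then obtain k where "q * a - 1 = int CARD('p) ^ n * k"
    unfolding cong_iff_dvd_diff by blast
  then have "(of_int (q * a - 1) :: 'p padic_int) = of_int (int CARD('p) ^ n * k)"
    by (rule arg_cong)
  then have "(of_int q * of_int a - 1 :: 'p padic_int) = of_nat CARD('p) ^ n * of_int k"
    by simp
  then show thesis
    by (intro that) (rule dvdI)
qed

lemma p_power_dvd_coprime_times:
  fixes x :: "'p::prime_card padic_int"
  assumes "coprime q (int CARD('p))"
  shows "of_nat CARD('p) ^ n dvd of_int q * x \<longleftrightarrow> of_nat CARD('p) ^ n dvd x"
proof
  obtain a where a: "of_nat CARD('p) ^ n dvd (of_int q * of_int a - 1 :: 'p padic_int)"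
    using inverse_mod_p_power[OF assms] by blast
  assume qx: "of_nat CARD('p) ^ n dvd of_int q * x"
  have "of_nat CARD('p) ^ n dvd of_int a * (of_int q * x) - (of_int q * of_int a - 1) * x"
    by (rule dvd_diff[OF dvd_mult[OF qx] dvd_mult2[OF a]])
  moreover have "of_int a * (of_int q * x) - (of_int q * of_int a - 1) * x = x"
    by (simp add: algebra_simps)
  ultimately show "of_nat CARD('p) ^ n dvd x"
    by (simp only:)
qed simp

section \<open>The functional equation of the map \<open>\<phi>\<close>\<close>

lemma p_power_dvd_suminf_minus_partial_sum:
  fixes a :: "nat \<Rightarrow> nat"
  defines "t \<equiv> \<lambda>i. of_nat (a i) * of_nat CARD('p) ^ i :: 'p::prime_card padic_int"
  shows "of_nat CARD('p) ^ n dvd suminf t - sum t {..<n}"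
proof -
  have "t sums suminf t"
    unfolding t_def by (intro summable_sums summable_padic_digits)
  then have "(\<lambda>m. sum t {..<m}) \<longlonglongrightarrow> suminf t"
    by (simp add: sums_def)
  moreover have "inverse (real CARD('p) ^ n) > 0"
    by simp
  ultimately have "\<forall>\<^sub>F m in sequentially. dist (sum t {..<m}) (suminf t) < inverse (real CARD('p) ^ n)"
    by (rule tendstoD)
  then obtain m where "m \<ge> n" "dist (sum t {..<m}) (suminf t) < inverse (real CARD('p) ^ n)"
    unfolding eventually_sequentially by (meson nle_le)
  then have close: "of_nat CARD('p) ^ n dvd suminf t - sum t {..<m}"
    by (simp add: dist_commute flip: dist_padic_int_le_iff)
  have "sum t {..<m} - sum t {..<n} = sum t {n..<m}"
    using \<open>n \<le> m\<close> by (simp add: sum_diff_nat_ivl lessThan_atLeast0)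
  moreover have "of_nat CARD('p) ^ n dvd sum t {n..<m}"
    by (intro dvd_sum) (auto simp: t_def le_imp_power_dvd)
  ultimately have "of_nat CARD('p) ^ n dvd (suminf t - sum t {..<m}) + (sum t {..<m} - sum t {..<n})"
    using close by simp
  then show ?thesis
    by simp
qed

text \<open>
  The two sides agree modulo every power \<open>p\<^sup>n\<close>, because modulo \<open>p\<^sup>n\<close> both series equal partial sums,
  and for these peeling off the first term is a finite identity.
\<close>

lemma phi_map_unfold:
  fixes u :: "'p::prime_card padic_int"
  shows "phi_map q u = of_nat (eps0 (- (of_int q * u))) + of_nat CARD('p) * phi_map q (g_map q u)"
    (is "_ = of_nat ?d + ?p * _")
proof (rule eq_if_all_p_powers_dvd)
  fix n
  define t where "t v i = of_nat (eps0 (- (of_int q * (g_map q ^^ i) v))) * ?p ^ i"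
    for v :: "'p padic_int" and i
  have approx: "?p ^ m dvd phi_map q v - sum (t v) {..<m}" for m v
    unfolding phi_map_def t_def by (rule p_power_dvd_suminf_minus_partial_sum)
  have "sum (t u) {..<Suc n} = of_nat ?d + ?p * sum (t (g_map q u)) {..<n}"
    unfolding sum.lessThan_Suc_shift
    by (simp add: t_def funpow_Suc_right sum_distrib_left mult_ac del: funpow.simps)
  then have "phi_map q u - (of_nat ?d + ?p * phi_map q (g_map q u))
      = (phi_map q u - sum (t u) {..<Suc n})
        - ?p * (phi_map q (g_map q u) - sum (t (g_map q u)) {..<n})"
    by (simp add: algebra_simps)
  moreover have "?p ^ n dvd phi_map q u - sum (t u) {..<Suc n}"
    using approx[of "Suc n" u] by (rule power_le_dvd) simp
  moreover have "?p ^ n dvd ?p * (phi_map q (g_map q u) - sum (t (g_map q u)) {..<n})"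
    using approx[of n "g_map q u"] by (rule dvd_mult)
  ultimately show "?p ^ n dvd phi_map q u - (of_nat ?d + ?p * phi_map q (g_map q u))"
    by (simp only: dvd_diff)
qed

section \<open>Preservation of congruences\<close>

lemma eps0_eq_iff:
  fixes x y :: "'p::prime_card padic_int"
  shows "eps0 x = eps0 y \<longleftrightarrow> of_nat CARD('p) dvd x - y"
proof
  assume "eps0 x = eps0 y"
  then show "of_nat CARD('p) dvd x - y"
    using dvd_diff[OF eps0_dvd[of x] eps0_dvd[of y]] by simp
next
  assume "of_nat CARD('p) dvd x - y"
  then have "of_nat CARD('p) dvd x - of_nat (eps0 y)"
    using dvd_add[OF _ eps0_dvd[of y]] by fastforce
  then show "eps0 x = eps0 y"
    by (rule eps0_eqI[OF eps0_less])
qed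

lemma digit_eq_iff:
  fixes u v :: "'p::prime_card padic_int"
  assumes "coprime q (int CARD('p))"
  shows "eps0 (- (of_int q * u)) = eps0 (- (of_int q * v)) \<longleftrightarrow> of_nat CARD('p) dvd u - v"
proof -
  have "- (of_int q * u) - - (of_int q * v) = - (of_int q * (u - v))"
    by (simp add: algebra_simps)
  then show ?thesis
    using p_power_dvd_coprime_times[OF assms, of 1 "u - v"] by (simp add: eps0_eq_iff)
qed

text \<open>
  Points that are congruent modulo \<open>p\<close> use the same branch of \<open>g\<close> with the same digit, so
  \<open>p (g u - g v)\<close> is \<open>u - v\<close> or \<open>q (u - v)\<close>, and \<open>q\<close> is a \<open>p\<close>-adic unit.
\<close>

lemma g_map_cong_iff:
  fixes u v :: "'p::prime_card padic_int"
  assumes q: "coprime q (int CARD('p))" and uv: "of_nat CARD('p) dvd u - v"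
  shows "of_nat CARD('p) ^ n dvd g_map q u - g_map q v \<longleftrightarrow> of_nat CARD('p) ^ Suc n dvd u - v"
proof -
  let ?p = "of_nat CARD('p) :: 'p padic_int"
  have branch: "?p dvd u \<longleftrightarrow> ?p dvd v"
    using dvd_add_left_iff[OF uv, of v] dvd_add_right_iff[OF uv, of v] by simp
  have digit: "eps0 (- (of_int q * u)) = eps0 (- (of_int q * v))"
    using digit_eq_iff[OF q] uv by blast
  have "?p ^ n dvd g_map q u - g_map q v \<longleftrightarrow> ?p ^ Suc n dvd ?p * g_map q u - ?p * g_map q v"
    by (simp only: p_power_Suc_dvd_p_times flip: right_diff_distrib)
  also have "\<dots> \<longleftrightarrow> ?p ^ Suc n dvd u - v"
  proof (cases "?p dvd v")
    case True
    then show ?thesis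
      by (simp only: g_map_exact branch if_True)
  next
    case False
    then have "?p * g_map q u - ?p * g_map q v = of_int q * (u - v)"
      by (simp add: g_map_exact branch digit right_diff_distrib)
    then show ?thesis
      by (simp only: p_power_dvd_coprime_times[OF q])
  qed
  finally show ?thesis .
qed

lemma phi_map_cong_iff:
  fixes u v :: "'p::prime_card padic_int"
  assumes q: "coprime q (int CARD('p))"
  shows "of_nat CARD('p) ^ n dvd phi_map q u - phi_map q v \<longleftrightarrow> of_nat CARD('p) ^ n dvd u - v"
proof (induction n arbitrary: u v)
  case (Suc n)
  let ?p = "of_nat CARD('p) :: 'p padic_int"
  let ?d = "\<lambda>w :: 'p padic_int. eps0 (- (of_int q * w))"
  have diff: "phi_map q u - phi_map q v
      = (of_nat (?d u) - of_nat (?d v)) + ?p * (phi_map q (g_map q u) - phi_map q (g_map q v))"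
    by (subst (1 2) phi_map_unfold) (simp add: algebra_simps)
  show ?case
  proof (cases "?p dvd u - v")
    case True
    then have "?d u = ?d v"
      using digit_eq_iff[OF q] by blast
    then have "phi_map q u - phi_map q v = ?p * (phi_map q (g_map q u) - phi_map q (g_map q v))"
      using diff by simp
    then have "?p ^ Suc n dvd phi_map q u - phi_map q v
        \<longleftrightarrow> ?p ^ n dvd phi_map q (g_map q u) - phi_map q (g_map q v)"
      by (simp only: p_power_Suc_dvd_p_times)
    then show ?thesis
      using Suc.IH g_map_cong_iff[OF q True] by blast
  next
    case False
    then have "?d u \<noteq> ?d v"
      using digit_eq_iff[OF q] by blast
    then have "\<not> ?p dvd of_nat (?d u) - of_nat (?d v)"
      by (simp add: digits_cong_iff eps0_less)
    then have "\<not> ?p dvd phi_map q u - phi_map q v"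
      unfolding diff by (simp add: dvd_add_left_iff)
    with False show ?thesis
      by (meson dvd_power dvd_trans zero_less_Suc)
  qed
qed simp

section \<open>Surjectivity\<close>

text \<open>
  A point \<open>u\<close> with first digit \<open>d\<close> whose image under \<open>g\<close> is \<open>v\<close> satisfies \<open>u = p v\<close> if \<open>d = 0\<close> and
  \<open>q u + d = p v\<close> otherwise. The second equation is solved with an inverse \<open>a\<close> of \<open>q\<close> modulo
  \<open>p\<^bsup>n+1\<^esup>\<close> only; this is why the conclusion is a congruence.
\<close>

lemma g_map_preimage_with_digit:
  fixes v :: "'p::prime_card padic_int"
  assumes q: "coprime q (int CARD('p))" and d: "d < CARD('p)"
  obtains u where "eps0 (- (of_int q * u)) = d" "of_nat CARD('p) ^ n dvd g_map q u - v"
proof (cases "d = 0")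
  case True
  have "eps0 (- (of_int q * (of_nat CARD('p) * v))) = d"
    using True by (intro eps0_eqI) (use d in auto)
  moreover have "g_map q (of_nat CARD('p) * v) = v"
    by (simp add: g_map_def of_nat_CARD_neq_0)
  ultimately show thesis
    by (intro that) auto
next
  case False
  let ?p = "of_nat CARD('p) :: 'p padic_int"
  obtain a where a: "?p ^ Suc n dvd of_int q * of_int a - 1"
    using inverse_mod_p_power[OF q] by blast
  define u where "u = of_int a * (?p * v - of_nat d)"
  have "of_int q * u + of_nat d - ?p * v = (of_int q * of_int a - 1) * (?p * v - of_nat d)"
    by (simp add: u_def algebra_simps)
  then have close: "?p ^ Suc n dvd of_int q * u + of_nat d - ?p * v"
    using a by simp
  then have "?p dvd of_int q * u + of_nat d - ?p * v"
    by (meson dvd_power dvd_trans zero_less_Suc)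
  then have "?p dvd - (of_int q * u + of_nat d - ?p * v + ?p * v)"
    by (simp only: dvd_minus_iff dvd_add dvd_triv_left)
  then have "?p dvd - (of_int q * u) - of_nat d"
    by simp
  then have digit: "eps0 (- (of_int q * u)) = d"
    by (rule eps0_eqI[OF d])
  have "\<not> ?p dvd u"
  proof
    assume "?p dvd u"
    then have "eps0 (- (of_int q * u)) = 0"
      by (intro eps0_eqI) auto
    with digit False show False
      by simp
  qed
  then have "?p * (g_map q u - v) = of_int q * u + of_nat d - ?p * v"
    by (simp add: right_diff_distrib g_map_exact digit)
  with close have "?p ^ n dvd g_map q u - v"
    by (metis p_power_Suc_dvd_p_times)
  with digit show thesis
    by (rule that)
qed

lemma phi_map_approx_surj:
  fixes w :: "'p::prime_card padic_int"
  assumes q: "coprime q (int CARD('p))"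
  shows "\<exists>u. of_nat CARD('p) ^ n dvd phi_map q u - w"
proof (induction n arbitrary: w)
  case (Suc n)
  let ?p = "of_nat CARD('p) :: 'p padic_int"
  obtain w' where "w - of_nat (eps0 w) = ?p * w'"
    using eps0_dvd[of w] by blast
  then have w: "w = of_nat (eps0 w) + ?p * w'"
    by (simp add: algebra_simps)
  obtain v where v: "?p ^ n dvd phi_map q v - w'"
    using Suc.IH by blast
  obtain u where digit: "eps0 (- (of_int q * u)) = eps0 w" and u: "?p ^ n dvd g_map q u - v"
    using g_map_preimage_with_digit[OF q eps0_less] by blast
  have "?p ^ n dvd phi_map q (g_map q u) - phi_map q v"
    using u by (simp only: phi_map_cong_iff[OF q])
  then have "?p ^ n dvd phi_map q (g_map q u) - w'"
    using dvd_add[OF _ v] by fastforce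
  moreover have "phi_map q u - w = ?p * (phi_map q (g_map q u) - w')"
    using phi_map_unfold[of q u] digit w by (simp add: algebra_simps)
  ultimately have "?p ^ Suc n dvd phi_map q u - w"
    by (simp only: p_power_Suc_dvd_p_times)
  then show ?case
    by blast
qed simp

lemma padic_limit:
  fixes x :: "nat \<Rightarrow> 'p::prime_card padic_int"
  assumes "\<And>n. of_nat CARD('p) ^ n dvd x (Suc n) - x n"
  obtains y where "\<And>n. of_nat CARD('p) ^ n dvd y - x n"
proof -
  have residues: "residue a n = residue b n"
    if "of_nat CARD('p) ^ n dvd a - b" for a b :: "'p padic_int" and n
    using that mod_eq_dvd_iff[of "residue a n" "int CARD('p) ^ n" "residue b n"]
    by (simp add: p_power_dvd_iff_residue residue_simps mod_eq_0_iff_dvd)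
  have "residue (x (Suc n)) (Suc n) mod int CARD('p) ^ n = residue (x n) n mod int CARD('p) ^ n" for n
    using residues[OF assms] by (simp add: residue_Suc_mod)
  then obtain y :: "'p padic_int" where
    "\<And>n. residue y n = residue (x n) n mod int CARD('p) ^ n"
    using padic_int_of_coherent[of "\<lambda>n. residue (x n) n"] by blast
  then have "of_nat CARD('p) ^ n dvd y - x n" for n
    by (simp add: p_power_dvd_iff_residue residue_simps)
  then show thesis
    by (rule that)
qed

lemma surj_phi_map:
  assumes q: "coprime q (int CARD('p::prime_card))"
  shows "surj (phi_map q :: 'p padic_int \<Rightarrow> 'p padic_int)"
proof (unfold surj_def, intro allI)
  fix w :: "'p padic_int"
  let ?p = "of_nat CARD('p) :: 'p padic_int"
  have "\<forall>n. \<exists>u. ?p ^ n dvd phi_map q u - w"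
    using phi_map_approx_surj[OF q] by blast
  from choice[OF this] obtain x where x: "\<And>n. ?p ^ n dvd phi_map q (x n) - w"
    by blast
  have "?p ^ n dvd x (Suc n) - x n" for n
  proof -
    have "?p ^ n dvd phi_map q (x (Suc n)) - w"
      using x[of "Suc n"] by (rule power_le_dvd) simp
    from dvd_diff[OF this x[of n]] have "?p ^ n dvd phi_map q (x (Suc n)) - phi_map q (x n)"
      by simp
    then show ?thesis
      by (simp only: phi_map_cong_iff[OF q])
  qed
  then obtain u where u: "\<And>n. ?p ^ n dvd u - x n"
    using padic_limit by blast
  have "?p ^ n dvd phi_map q u - w" for n
  proof -
    have "?p ^ n dvd phi_map q u - phi_map q (x n)"
      using u by (simp only: phi_map_cong_iff[OF q])
    from dvd_add[OF this x[of n]] show ?thesis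
      by simp
  qed
  then have "phi_map q u = w"
    by (rule eq_if_all_p_powers_dvd)
  then show "\<exists>u. w = phi_map q u"
    by blast
qed

section \<open>The isometry\<close>

lemma dist_eq_if_same_p_power_divisors:
  fixes x y x' y' :: "'p::prime_card padic_int"
  assumes "\<And>n. of_nat CARD('p) ^ n dvd x' - y' \<longleftrightarrow> of_nat CARD('p) ^ n dvd x - y"
  shows "dist x' y' = dist x y"
proof -
  have "x' = y' \<longleftrightarrow> x = y"
    using assms eq_if_all_p_powers_dvd by (metis diff_self dvd_0_right)
  then show ?thesis
    by (simp add: dist_padic_int_def padic_val_def assms)
qed

theorem proposition9:
  fixes q :: int
  assumes "q \<noteq> 0"
    and "coprime q (int CARD('p::prime_card))"
  shows "isometry (phi_map q :: 'p padic_int \<Rightarrow> 'p padic_int)"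
proof -
  have dist: "dist (phi_map q x) (phi_map q y) = dist x y" for x y :: "'p padic_int"
    using phi_map_cong_iff[OF assms(2)] by (rule dist_eq_if_same_p_power_divisors)
  then have "inj (phi_map q :: 'p padic_int \<Rightarrow> 'p padic_int)"
    by (metis dist_eq_0_iff injI)
  with surj_phi_map[OF assms(2)] dist show ?thesis
    by (simp add: isometry_def bij_def)
qed

end
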